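(* Let $X$ and $Y$ be complex-affine manifolds that each admit finitely many locally nilpotent derivations generating an infinitely transitive action on $X$ and $Y$, respectively. Then $X\times Y$ admits finitely many locally nilpotent derivations generating an infinitely transitive action on the direct product $X\times Y$.
   Context: A complex-affine manifold is a smooth affine algebraic variety over $\mathbb{C}$. Locally nilpotent derivations (LNDs) are derivations of the coordinate ring, identified with algebraic vector fields; their flows are algebraic one-parameter groups of automorphisms. Finitely many LNDs "generate an infinitely transitive action" if the group of automorphisms generated by their flows acts $m$-transitively for every $m\in\mathbb{N}$, i.e. any $m$-tuple of pairwise distinct points can be mapped to any other such $m$-tuple by an element of the group. *)

theory Defs
  imports
    "HOL-Analysis.Analysis"
    "HOL-Library.Extended_Nat"
    "HOL-Library.FuncSet"
    "HOL-Algebra.Bij"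
    "HOL-Algebra.Generated_Groups"
begin

section \<open>Affine algebraic varieties in complex affine space\<close>

text \<open>
  Since the field of complex numbers is infinite, polynomials in the coordinates are identified
  with the functions they induce.
\<close>

inductive_set poly_funs :: "(complex ^ 'n \<Rightarrow> complex) set" where
  const: "(\<lambda>x. c) \<in> poly_funs"
| coord: "(\<lambda>x. x $ i) \<in> poly_funs"
| add: "p \<in> poly_funs \<Longrightarrow> q \<in> poly_funs \<Longrightarrow> (\<lambda>x. p x + q x) \<in> poly_funs"
| mult: "p \<in> poly_funs \<Longrightarrow> q \<in> poly_funs \<Longrightarrow> (\<lambda>x. p x * q x) \<in> poly_funs"

definition zero_locus :: "(complex ^ 'n \<Rightarrow> complex) set \<Rightarrow> (complex ^ 'n) set" where
  "zero_locus P = {x. \<forall>p\<in>P. p x = 0}"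

definition vanishing_ideal :: "(complex ^ 'n) set \<Rightarrow> (complex ^ 'n \<Rightarrow> complex) set" where
  "vanishing_ideal X = {p \<in> poly_funs. \<forall>x\<in>X. p x = 0}"

definition zariski_closed :: "(complex ^ 'n) set \<Rightarrow> bool" where
  "zariski_closed X \<longleftrightarrow> (\<exists>P \<subseteq> poly_funs. X = zero_locus P)"

definition irreducible_closed :: "(complex ^ 'n) set \<Rightarrow> bool" where
  "irreducible_closed Z \<longleftrightarrow> zariski_closed Z \<and> Z \<noteq> {} \<and>
     (\<forall>A B. zariski_closed A \<and> zariski_closed B \<and> Z = A \<union> B \<longrightarrow> Z = A \<or> Z = B)"

text \<open>
  The local dimension at \<open>a\<close> is the Krull dimension of the local ring of \<open>X\<close> at \<open>a\<close>: chains of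
  prime ideals of that ring correspond to chains of irreducible closed subsets of \<open>X\<close> through \<open>a\<close>.
\<close>

definition local_dim :: "(complex ^ 'n) set \<Rightarrow> complex ^ 'n \<Rightarrow> enat" where
  "local_dim X a = Sup {enat k | k. \<exists>Z :: nat \<Rightarrow> (complex ^ 'n) set.
     (\<forall>i\<le>k. irreducible_closed (Z i) \<and> a \<in> Z i \<and> Z i \<subseteq> X) \<and> (\<forall>i<k. Z i \<subset> Z (Suc i))}"

definition zariski_tangent_space :: "(complex ^ 'n) set \<Rightarrow> complex ^ 'n \<Rightarrow> (complex ^ 'n) set" where
  "zariski_tangent_space X a =
     {v. \<forall>p\<in>vanishing_ideal X. ((\<lambda>t. p (a + t *s v)) has_field_derivative 0) (at 0)}"

text \<open>
  A smooth affine variety: all its local rings are regular. Neither irreducibility nor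
  nonemptiness is required.
\<close>

definition complex_affine_manifold :: "(complex ^ 'n) set \<Rightarrow> bool" where
  "complex_affine_manifold X \<longleftrightarrow> zariski_closed X \<and>
     (\<forall>a\<in>X. enat (vec.dim (zariski_tangent_space X a)) = local_dim X a)"

definition affine_product ::
    "(complex ^ 'n) set \<Rightarrow> (complex ^ 'm) set \<Rightarrow> (complex ^ ('n + 'm)) set" where
  "affine_product X Y = {z. (\<chi> i. z $ Inl i) \<in> X \<and> (\<chi> j. z $ Inr j) \<in> Y}"

section \<open>Locally nilpotent derivations and their flows\<close>

definition coordinate_ring :: "(complex ^ 'n) set \<Rightarrow> (complex ^ 'n \<Rightarrow> complex) set" where
  "coordinate_ring X = (\<lambda>p. restrict p X) ` poly_funs"

text \<open>Derivations are \<open>\<complex>\<close>-linear; only their values on the coordinate ring matter.\<close>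

definition derivation ::
    "(complex ^ 'n) set \<Rightarrow> ((complex ^ 'n \<Rightarrow> complex) \<Rightarrow> complex ^ 'n \<Rightarrow> complex) \<Rightarrow> bool" where
  "derivation X D \<longleftrightarrow>
     D \<in> coordinate_ring X \<rightarrow> coordinate_ring X \<and>
     (\<forall>f\<in>coordinate_ring X. \<forall>g\<in>coordinate_ring X.
        D (\<lambda>x\<in>X. f x + g x) = (\<lambda>x\<in>X. D f x + D g x)) \<and>
     (\<forall>c. \<forall>f\<in>coordinate_ring X. D (\<lambda>x\<in>X. c * f x) = (\<lambda>x\<in>X. c * D f x)) \<and>
     (\<forall>f\<in>coordinate_ring X. \<forall>g\<in>coordinate_ring X.
        D (\<lambda>x\<in>X. f x * g x) = (\<lambda>x\<in>X. D f x * g x + f x * D g x))"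

definition locally_nilpotent_derivation ::
    "(complex ^ 'n) set \<Rightarrow> ((complex ^ 'n \<Rightarrow> complex) \<Rightarrow> complex ^ 'n \<Rightarrow> complex) \<Rightarrow> bool" where
  "locally_nilpotent_derivation X D \<longleftrightarrow>
     derivation X D \<and> (\<forall>f\<in>coordinate_ring X. \<exists>k. (D ^^ k) f = (\<lambda>x\<in>X. 0))"

text \<open>
  \<open>\<phi>\<close> is the complex-time flow on \<open>X\<close> of \<open>D\<close>, regarded as a vector field. If \<open>D\<close> is locally nilpotent
  and \<open>X\<close> is Zariski closed, there is exactly one such flow on \<open>X\<close>, given by
  \<open>f (\<phi> t x) = (\<Sum>k. t ^ k / fact k * (D ^^ k) f x)\<close>.
\<close>

definition is_flow ::
    "(complex ^ 'n) set \<Rightarrow> ((complex ^ 'n \<Rightarrow> complex) \<Rightarrow> complex ^ 'n \<Rightarrow> complex) \<Rightarrow>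
     (complex \<Rightarrow> complex ^ 'n \<Rightarrow> complex ^ 'n) \<Rightarrow> bool" where
  "is_flow X D \<phi> \<longleftrightarrow>
     (\<forall>t. \<phi> t \<in> X \<rightarrow> X) \<and> (\<forall>x\<in>X. \<phi> 0 x = x) \<and>
     (\<forall>f\<in>coordinate_ring X. \<forall>x\<in>X. \<forall>t.
        ((\<lambda>s. f (\<phi> s x)) has_field_derivative D f (\<phi> t x)) (at t))"

text \<open>
  The generated group is formed inside the group of all bijections of \<open>X\<close>; the time-\<open>t\<close> maps are
  automorphisms of \<open>X\<close>, so this is the subgroup they generate in the automorphism group.
\<close>

definition flow_group ::
    "(complex ^ 'n) set \<Rightarrow> ((complex ^ 'n \<Rightarrow> complex) \<Rightarrow> complex ^ 'n \<Rightarrow> complex) set \<Rightarrow>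
     (complex ^ 'n \<Rightarrow> complex ^ 'n) set" where
  "flow_group X S = generate (BijGroup X) {restrict (\<phi> t) X | D \<phi> t. D \<in> S \<and> is_flow X D \<phi>}"

definition m_transitive :: "nat \<Rightarrow> 'a set \<Rightarrow> ('a \<Rightarrow> 'a) set \<Rightarrow> bool" where
  "m_transitive m X G \<longleftrightarrow>
     (\<forall>xs ys. length xs = m \<and> length ys = m \<and> distinct xs \<and> distinct ys \<and>
        set xs \<subseteq> X \<and> set ys \<subseteq> X \<longrightarrow> (\<exists>g\<in>G. map g xs = ys))"

definition infinitely_transitive :: "'a set \<Rightarrow> ('a \<Rightarrow> 'a) set \<Rightarrow> bool" where
  "infinitely_transitive X G \<longleftrightarrow> (\<forall>m. m_transitive m X G)"

definition finitely_many_LNDs_infinitely_transitive :: "(complex ^ 'n) set \<Rightarrow> bool" where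
  "finitely_many_LNDs_infinitely_transitive X \<longleftrightarrow>
     (\<exists>S. finite S \<and> (\<forall>D\<in>S. locally_nilpotent_derivation X D) \<and>
        infinitely_transitive X (flow_group X S))"

end

theory Submission
  imports Defs
begin

text \<open>
  A locally nilpotent derivation \<open>D\<close> of \<open>X\<close> and a regular function \<open>h\<close> on \<open>Y\<close> give the locally nilpotent
  derivation \<open>h D\<close> of the product, whose flow moves \<open>(x, y)\<close> to \<open>(\<phi> (h y * t) x, y)\<close>. Conjugating this
  shear by suitable elements of the infinitely transitive group on \<open>Y\<close>, for a single nonconstant \<open>h\<close>,
  one can apply any element of the group on \<open>X\<close> in one fibre over \<open>Y\<close> and leave finitely many other
  fibres pointwise fixed; the same holds with \<open>X\<close> and \<open>Y\<close> exchanged. Hence distinct points of the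
  product can first be given prescribed distinct \<open>X\<close>-coordinates \<open>\<xi> i\<close>, and then a common
  \<open>Y\<close>-coordinate \<open>\<upsilon>\<close>, so any two tuples lie in the orbit of \<open>(\<xi> i, \<upsilon>)\<close>. Coordinate functions suffice for
  \<open>h\<close>. A factor with two points is infinite, since a nontrivial flow line is the image of a connected
  set; one with fewer points is trivial to treat.
\<close>

text \<open>The unconditional rule would turn function-valued restrictions into conditionals.\<close>

declare restrict_apply [simp del] restrict_apply' [simp]

section \<open>Coordinate rings and iterates of derivations\<close>

lemma coordinate_ringI: "p \<in> poly_funs \<Longrightarrow> restrict p X \<in> coordinate_ring X"
  by (auto simp: coordinate_ring_def)

lemma coordinate_ring_smult:
  assumes "f \<in> coordinate_ring X"
  shows "(\<lambda>x\<in>X. c * f x) \<in> coordinate_ring X"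
proof -
  obtain p where "p \<in> poly_funs" "f = restrict p X"
    using assms by (auto simp: coordinate_ring_def)
  then show ?thesis
    by (auto simp: coordinate_ring_def intro!: image_eqI[of _ _ "\<lambda>x. c * p x"] poly_funs.intros cong: restrict_cong)
qed

lemma coordinate_ring_add:
  assumes "f \<in> coordinate_ring X" "g \<in> coordinate_ring X"
  shows "(\<lambda>x\<in>X. f x + g x) \<in> coordinate_ring X"
proof -
  obtain p q where "p \<in> poly_funs" "f = restrict p X" "q \<in> poly_funs" "g = restrict q X"
    using assms by (auto simp: coordinate_ring_def)
  then show ?thesis
    by (auto simp: coordinate_ring_def intro!: image_eqI[of _ _ "\<lambda>x. p x + q x"] poly_funs.intros cong: restrict_cong)
qed

lemma derivation_in: "derivation X D \<Longrightarrow> f \<in> coordinate_ring X \<Longrightarrow> D f \<in> coordinate_ring X"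
  by (auto simp: derivation_def)

lemma derivation_add:
  "derivation X D \<Longrightarrow> f \<in> coordinate_ring X \<Longrightarrow> g \<in> coordinate_ring X \<Longrightarrow>
    D (\<lambda>x\<in>X. f x + g x) = (\<lambda>x\<in>X. D f x + D g x)"
  by (auto simp: derivation_def)

lemma derivation_smult:
  "derivation X D \<Longrightarrow> f \<in> coordinate_ring X \<Longrightarrow> D (\<lambda>x\<in>X. c * f x) = (\<lambda>x\<in>X. c * D f x)"
  by (auto simp: derivation_def)

lemma derivation_mult:
  "derivation X D \<Longrightarrow> f \<in> coordinate_ring X \<Longrightarrow> g \<in> coordinate_ring X \<Longrightarrow>
    D (\<lambda>x\<in>X. f x * g x) = (\<lambda>x\<in>X. D f x * g x + f x * D g x)"
  by (auto simp: derivation_def)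

lemma derivation_funpow_in:
  "derivation X D \<Longrightarrow> f \<in> coordinate_ring X \<Longrightarrow> (D ^^ k) f \<in> coordinate_ring X"
  by (induction k) (auto intro: derivation_in)

lemma derivation_funpow_add:
  assumes "derivation X D" "f \<in> coordinate_ring X" "g \<in> coordinate_ring X"
  shows "(D ^^ k) (\<lambda>x\<in>X. f x + g x) = (\<lambda>x\<in>X. (D ^^ k) f x + (D ^^ k) g x)"
  by (induction k) (simp_all add: assms derivation_add derivation_funpow_in)

lemma derivation_funpow_smult:
  assumes "derivation X D" "f \<in> coordinate_ring X"
  shows "(D ^^ k) (\<lambda>x\<in>X. c * f x) = (\<lambda>x\<in>X. c * (D ^^ k) f x)"
  by (induction k) (simp_all add: assms derivation_smult derivation_funpow_in)

lemma derivation_zero: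
  assumes "derivation X D"
  shows "D (\<lambda>x\<in>X. 0) = (\<lambda>x\<in>X. 0)"
  using derivation_smult[OF assms coordinate_ringI[OF poly_funs.const], of 0 0] by simp

lemma derivation_funpow_zero_mono:
  assumes "derivation X D" "(D ^^ k) f = (\<lambda>x\<in>X. 0)" "k \<le> j"
  shows "(D ^^ j) f = (\<lambda>x\<in>X. 0)"
  using assms(3) by (induction j rule: dec_induct) (simp_all add: assms derivation_zero)

section \<open>Integral curves and the one-parameter group law\<close>

text \<open>Local nilpotency allows induction on the exponent that kills \<open>f\<close>. The
  hypothesis for \<open>D f\<close> says that \<open>f\<close> has the same derivative along both
  curves, so the difference of its values is constant, and it vanishes at time 0.\<close>

lemma integral_curve_unique:
  assumes D: "locally_nilpotent_derivation X D" and f: "f \<in> coordinate_ring X"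
    and u: "\<And>f t. f \<in> coordinate_ring X \<Longrightarrow>
      ((\<lambda>s. f (u s)) has_field_derivative D f (u t)) (at t)" "\<And>t. u t \<in> X"
    and v: "\<And>f t. f \<in> coordinate_ring X \<Longrightarrow>
      ((\<lambda>s. f (v s)) has_field_derivative D f (v t)) (at t)" "\<And>t. v t \<in> X"
    and eq: "u 0 = v 0"
  shows "f (u t) = f (v t)"
proof -
  have der: "derivation X D" using D by (simp add: locally_nilpotent_derivation_def)
  obtain k where "(D ^^ k) f = (\<lambda>x\<in>X. 0)"
    using D f by (auto simp: locally_nilpotent_derivation_def)
  then show ?thesis using f
  proof (induction k arbitrary: f t)
    case 0
    then show ?case using u v by simp
  next
    case (Suc k)
    have "(D ^^ k) (D f) = (\<lambda>x\<in>X. 0)"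
      using Suc.prems(1) by (simp add: funpow_swap1)
    then have Df: "D f (u s) = D f (v s)" for s
      using Suc derivation_in[OF der] by blast
    have "((\<lambda>s. f (u s) - f (v s)) has_field_derivative 0) (at s)" for s
      using DERIV_diff[OF u(1) v(1), OF Suc.prems(2) Suc.prems(2)] Df by simp
    then obtain c where "\<forall>s. f (u s) - f (v s) = c"
      using has_field_derivative_zero_constant[of UNIV "\<lambda>s. f (u s) - f (v s)"] by auto
    then have "f (u t) - f (v t) = f (u 0) - f (v 0)" by simp
    then show ?case by (simp add: eq)
  qed
qed

lemma eq_if_coordinate_ring_eq:
  assumes "\<And>f. f \<in> coordinate_ring X \<Longrightarrow> f x = f y" "x \<in> X" "y \<in> X"
  shows "x = y"
proof -
  have "x $ i = y $ i" for i
    using assms(1)[OF coordinate_ringI[OF poly_funs.coord[of i]]] assms by simp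
  then show ?thesis by (simp add: vec_eq_iff)
qed

text \<open>As functions of \<open>s\<close>, both sides are integral curves of \<open>D\<close>
  that start at \<open>\<phi> t x\<close>, so every regular function, and in particular every
  coordinate, agrees on them.\<close>

lemma flow_add:
  assumes D: "locally_nilpotent_derivation X D" and \<phi>: "is_flow X D \<phi>" and x: "x \<in> X"
  shows "\<phi> s (\<phi> t x) = \<phi> (s + t) x"
proof (rule eq_if_coordinate_ring_eq[of X])
  fix f assume f: "f \<in> coordinate_ring X"
  have in_X: "\<phi> t x \<in> X" if "x \<in> X" for t x
    using \<phi> that by (auto simp: is_flow_def)
  have der: "((\<lambda>s. f (\<phi> s x)) has_field_derivative D f (\<phi> t x)) (at t)"
    if "f \<in> coordinate_ring X" "x \<in> X" for f t x
    using \<phi> that by (auto simp: is_flow_def)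
  show "f (\<phi> s (\<phi> t x)) = f (\<phi> (s + t) x)"
  proof (rule integral_curve_unique[OF D f, where u = "\<lambda>s. \<phi> s (\<phi> t x)" and v = "\<lambda>s. \<phi> (s + t) x"])
    fix f s assume f: "f \<in> coordinate_ring X"
    show "((\<lambda>s. f (\<phi> s (\<phi> t x))) has_field_derivative D f (\<phi> s (\<phi> t x))) (at s)"
      using f x by (intro der in_X)
    show "((\<lambda>s. f (\<phi> (s + t) x)) has_field_derivative D f (\<phi> (s + t) x)) (at s)"
      using der[OF f x, of "s + t"] by (subst (asm) DERIV_shift) simp
  qed (use in_X x \<phi> in \<open>auto simp: is_flow_def\<close>)
qed (use \<phi> x in \<open>auto simp: is_flow_def Pi_iff\<close>)

lemma flow_inverse:
  assumes "locally_nilpotent_derivation X D" "is_flow X D \<phi>" "x \<in> X"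
  shows "\<phi> (- t) (\<phi> t x) = x"
  using flow_add[OF assms, of "-t" t] assms by (simp add: is_flow_def)

section \<open>The group generated by flows\<close>

lemma flow_in_Bij:
  assumes D: "locally_nilpotent_derivation X D" and \<phi>: "is_flow X D \<phi>"
  shows "restrict (\<phi> t) X \<in> Bij X"
proof -
  have "bij_betw (\<phi> t) X X"
    using flow_inverse[OF D \<phi>, of _ t] flow_inverse[OF D \<phi>, of _ "-t"] \<phi>
    by (intro bij_betw_byWitness[where f' = "\<phi> (-t)"]) (auto simp: is_flow_def)
  then show ?thesis by (simp add: Bij_def bij_betw_restrict_eq)
qed

lemma inv_flow_BijGroup:
  assumes D: "locally_nilpotent_derivation X D" and \<phi>: "is_flow X D \<phi>"
  shows "inv\<^bsub>BijGroup X\<^esub> (restrict (\<phi> t) X) = restrict (\<phi> (- t)) X"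
proof (rule group.inv_equality[OF group_BijGroup])
  show "restrict (\<phi> (- t)) X \<otimes>\<^bsub>BijGroup X\<^esub> restrict (\<phi> t) X = \<one>\<^bsub>BijGroup X\<^esub>"
    using flow_in_Bij[OF D \<phi>] flow_inverse[OF D \<phi>] \<phi>
    by (auto simp: BijGroup_def compose_def is_flow_def Pi_iff fun_eq_iff restrict_apply restrict_def)
qed (use flow_in_Bij[OF D \<phi>] in \<open>auto simp: BijGroup_def\<close>)

lemma subgroup_flow_group:
  assumes "\<forall>D\<in>S. locally_nilpotent_derivation X D"
  shows "subgroup (flow_group X S) (BijGroup X)"
  unfolding flow_group_def
  using assms by (intro group.generate_is_subgroup group_BijGroup)
    (auto simp: BijGroup_def intro!: flow_in_Bij)

lemma flow_in_flow_group:
  "D \<in> S \<Longrightarrow> is_flow X D \<phi> \<Longrightarrow> restrict (\<phi> t) X \<in> flow_group X S"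
  unfolding flow_group_def by (intro generate.incl) auto

text \<open>There is no case for inverses: by \<open>inv_flow_BijGroup\<close> the inverse of a
  generator is the flow map at the opposite time, again a generator. Membership in
  \<open>Bij X\<close> is passed to the composition case so that composites can be evaluated on
  \<open>X\<close>.\<close>

lemma flow_group_induct [consumes 2, case_names id flow compose]:
  assumes S: "\<forall>D\<in>S. locally_nilpotent_derivation X D" and g: "g \<in> flow_group X S"
    and id: "P (\<lambda>x\<in>X. x)"
    and flow: "\<And>D \<phi> t. D \<in> S \<Longrightarrow> is_flow X D \<phi> \<Longrightarrow> P (restrict (\<phi> t) X)"
    and comp: "\<And>f g. f \<in> Bij X \<Longrightarrow> g \<in> Bij X \<Longrightarrow> P f \<Longrightarrow> P g \<Longrightarrow> P (compose X f g)"
  shows "P g"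
proof -
  have sub: "flow_group X S \<subseteq> Bij X"
    using subgroup.subset[OF subgroup_flow_group[OF S]] by (simp add: BijGroup_def)
  show ?thesis using g unfolding flow_group_def
  proof induction
    case one
    then show ?case using id by (simp add: BijGroup_def)
  next
    case (incl h)
    then show ?case using flow by auto
  next
    case (inv h)
    then show ?case using S inv_flow_BijGroup flow by fastforce
  next
    case (eng f g)
    then have "f \<in> Bij X" "g \<in> Bij X" using sub by (auto simp: flow_group_def)
    then show ?case using comp eng by (simp add: BijGroup_def)
  qed
qed

section \<open>Subgroups of a group of bijections, through values on \<open>Z\<close>\<close>

context
  fixes G :: "('a \<Rightarrow> 'a) set" and Z :: "'a set"
  assumes G: "subgroup G (BijGroup Z)"
begin

lemma subgroup_BijGroup_Bij: "\<gamma> \<in> G \<Longrightarrow> \<gamma> \<in> Bij Z"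
  using subgroup.subset[OF G] by (auto simp: BijGroup_def)

lemma subgroup_BijGroup_mem: "\<gamma> \<in> G \<Longrightarrow> z \<in> Z \<Longrightarrow> \<gamma> z \<in> Z"
  using subgroup_BijGroup_Bij[of \<gamma>] by (auto simp: Bij_def bij_betw_def)

lemma subgroup_BijGroup_id: "\<exists>\<gamma>\<in>G. \<forall>z\<in>Z. \<gamma> z = z"
  using subgroup.one_closed[OF G] by (intro bexI[of _ "\<lambda>x\<in>Z. x"]) (simp_all add: BijGroup_def)

lemma subgroup_BijGroup_compose:
  assumes "\<gamma> \<in> G" "\<delta> \<in> G"
  shows "\<exists>\<epsilon>\<in>G. \<forall>z\<in>Z. \<epsilon> z = \<gamma> (\<delta> z)"
  using subgroup.m_closed[OF G assms] subgroup_BijGroup_Bij[OF assms(1)] subgroup_BijGroup_Bij[OF assms(2)]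
  by (intro bexI[of _ "\<gamma> \<otimes>\<^bsub>BijGroup Z\<^esub> \<delta>"]) (simp_all add: BijGroup_def compose_def)

lemma subgroup_BijGroup_inverse:
  assumes "\<gamma> \<in> G"
  shows "\<exists>\<epsilon>\<in>G. \<forall>z\<in>Z. \<epsilon> (\<gamma> z) = z"
proof (intro bexI ballI)
  fix z assume z: "z \<in> Z"
  have "inj_on \<gamma> Z" using subgroup_BijGroup_Bij[OF assms] by (simp add: Bij_def bij_betw_def)
  then show "(inv\<^bsub>BijGroup Z\<^esub> \<gamma>) (\<gamma> z) = z"
    using z subgroup_BijGroup_mem[OF assms z]
    by (simp add: inv_BijGroup[OF subgroup_BijGroup_Bij[OF assms]])
qed (use subgroup.m_inv_closed[OF G assms] in simp)

end

section \<open>Consequences of infinite transitivity\<close>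

text \<open>A distinct enumeration of \<open>I\<close> turns families into tuples. Families suit the
  later arguments, where subsets of the indices are selected by conditions on the points.\<close>

lemma infinitely_transitive_finite_family:
  assumes G: "infinitely_transitive X G" and "finite I"
    and u: "inj_on u I" "u ` I \<subseteq> X" and v: "inj_on v I" "v ` I \<subseteq> X"
  shows "\<exists>g\<in>G. \<forall>i\<in>I. g (u i) = v i"
proof -
  obtain js where js: "set js = I" "distinct js"
    using finite_distinct_list[OF \<open>finite I\<close>] by blast
  have "\<exists>g\<in>G. map g (map u js) = map v js"
    using G[unfolded infinitely_transitive_def m_transitive_def, rule_format,
        of "map u js" "length js" "map v js"] js u v
    by (simp add: distinct_map)
  then show ?thesis using js by auto
qed

text \<open>On a finite \<open>X\<close>, each coordinate along a flow line would be a continuous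
  function on the connected plane with finite range, hence constant. All flows, and so the whole
  group, would fix every point, yet some element moves \<open>a\<close> to \<open>b\<close>.\<close>

lemma infinite_if_flow_group_transitive:
  fixes X :: "(complex ^ 'n) set"
  assumes S: "\<forall>D\<in>S. locally_nilpotent_derivation X D"
    and tr: "infinitely_transitive X (flow_group X S)"
    and ab: "a \<in> X" "b \<in> X" "a \<noteq> b"
  shows "infinite X"
proof
  assume fin: "finite X"
  have flow_id: "\<phi> t x = x" if \<phi>: "is_flow X D \<phi>" and x: "x \<in> X" for D \<phi> t x
  proof -
    have in_X: "\<phi> s x \<in> X" for s using \<phi> x by (auto simp: is_flow_def)
    have "\<phi> t x $ i = \<phi> 0 x $ i" for i
    proof -
      let ?f = "restrict (\<lambda>x. x $ i) X"
      have "((\<lambda>s. ?f (\<phi> s x)) has_field_derivative D ?f (\<phi> t x)) (at t)" for t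
        using \<phi> x coordinate_ringI[OF poly_funs.coord[of i], of X] by (simp add: is_flow_def)
      then have "continuous_on UNIV (\<lambda>s. ?f (\<phi> s x))"
        by (meson continuous_at_imp_continuous_on DERIV_isCont)
      moreover have "finite (range (\<lambda>s. ?f (\<phi> s x)))"
        by (rule finite_subset[OF _ finite_imageI[OF fin, of ?f]]) (use in_X in auto)
      ultimately have "(\<lambda>s. ?f (\<phi> s x)) constant_on UNIV"
        by (intro continuous_finite_range_constant) auto
      then have "?f (\<phi> t x) = ?f (\<phi> 0 x)" by (auto simp: constant_on_def)
      then show ?thesis using in_X by simp
    qed
    then show ?thesis using \<phi> x by (simp add: is_flow_def vec_eq_iff)
  qed
  have "\<forall>x\<in>X. g x = x" if "g \<in> flow_group X S" for g
    using S that
    by (induction rule: flow_group_induct) (auto simp: flow_id compose_def)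
  \<comment> \<open>Only 1-transitivity is needed here, so the index set is a singleton.\<close>
  moreover obtain g where "g \<in> flow_group X S" "g a = b"
    using infinitely_transitive_finite_family[OF tr, of "{()}" "\<lambda>_. a" "\<lambda>_. b"] ab by auto
  ultimately show False using ab by metis
qed

section \<open>Coordinates and regular functions on a product\<close>

text \<open>Abstract projections make the setting symmetric: \<open>flip\<close> exchanges the
  factors over the same index type \<open>'k\<close>, whereas exchanging them in the concrete
  product would change \<open>'n + 'm\<close> to \<open>'m + 'n\<close>. Each result below can thus
  be used for either factor.\<close>

locale product_coordinates =
  fixes \<pi> :: "complex ^ 'k \<Rightarrow> complex ^ 'n" and \<rho> :: "complex ^ 'k \<Rightarrow> complex ^ 'm"
    and pair :: "complex ^ 'n \<Rightarrow> complex ^ 'm \<Rightarrow> complex ^ 'k"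
    and X :: "(complex ^ 'n) set" and Y :: "(complex ^ 'm) set" and Z :: "(complex ^ 'k) set"
  assumes pair_surj [simp]: "pair (\<pi> z) (\<rho> z) = z"
    and \<pi>_pair [simp]: "\<pi> (pair x y) = x" and \<rho>_pair [simp]: "\<rho> (pair x y) = y"
    and \<pi>_poly: "(\<lambda>z. \<pi> z $ i) \<in> poly_funs" and \<rho>_poly: "(\<lambda>z. \<rho> z $ j) \<in> poly_funs"
    and coord_cases: "(\<exists>i. \<forall>z. z $ l = \<pi> z $ i) \<or> (\<exists>j. \<forall>z. z $ l = \<rho> z $ j)"
    and mem_Z: "z \<in> Z \<longleftrightarrow> \<pi> z \<in> X \<and> \<rho> z \<in> Y"
begin

lemma flip: "product_coordinates \<rho> \<pi> (\<lambda>y x. pair x y) Y X Z"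
  by unfold_locales (use \<pi>_poly \<rho>_poly coord_cases mem_Z in auto)

lemma poly_funs_\<pi>: "p \<in> poly_funs \<Longrightarrow> (\<lambda>z. p (\<pi> z)) \<in> poly_funs"
  by (induction rule: poly_funs.induct) (auto intro: poly_funs.intros \<pi>_poly)

lemma poly_funs_\<rho>: "p \<in> poly_funs \<Longrightarrow> (\<lambda>z. p (\<rho> z)) \<in> poly_funs"
  by (induction rule: poly_funs.induct) (auto intro: poly_funs.intros \<rho>_poly)

text \<open>The image of the tensor product of the two polynomial rings. Freezing the second
  coordinate turns a product into a scalar multiple of one fixed function on \<open>X\<close>, so
  induction over sums of products controls all slices at once.\<close>

inductive_set tensors :: "(complex ^ 'k \<Rightarrow> complex) set" where
  prod: "a \<in> poly_funs \<Longrightarrow> b \<in> poly_funs \<Longrightarrow> (\<lambda>z. a (\<pi> z) * b (\<rho> z)) \<in> tensors"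
| sum: "p \<in> tensors \<Longrightarrow> q \<in> tensors \<Longrightarrow> (\<lambda>z. p z + q z) \<in> tensors"

lemma tensors_poly: "p \<in> tensors \<Longrightarrow> p \<in> poly_funs"
  by (induction rule: tensors.induct) (auto intro: poly_funs.intros poly_funs_\<pi> poly_funs_\<rho>)

lemma tensors_mult:
  assumes "p \<in> tensors" "q \<in> tensors"
  shows "(\<lambda>z. p z * q z) \<in> tensors"
  using assms(1)
proof induction
  case (prod a b)
  show ?case using assms(2)
  proof induction
    case (prod a' b')
    have "(\<lambda>z. (a (\<pi> z) * a' (\<pi> z)) * (b (\<rho> z) * b' (\<rho> z))) \<in> tensors"
      by (intro tensors.prod[of "\<lambda>x. a x * a' x" "\<lambda>y. b y * b' y"] poly_funs.mult prod \<open>a \<in> poly_funs\<close> \<open>b \<in> poly_funs\<close>)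
    then show ?case by (simp add: mult_ac)
  next
    case (sum p q)
    then show ?case using tensors.sum by (fastforce simp: distrib_left)
  qed
next
  case (sum p q)
  then show ?case using tensors.sum by (fastforce simp: distrib_right)
qed

text \<open>Each coordinate depends on one factor only, so it is a product with the constant 1;
  closure under multiplication is \<open>tensors_mult\<close>.\<close>

lemma poly_tensors: "p \<in> poly_funs \<Longrightarrow> p \<in> tensors"
proof (induction rule: poly_funs.induct)
  case (const c)
  show ?case using tensors.prod[OF poly_funs.const[of c] poly_funs.const[of 1]] by simp
next
  case (coord l)
  show ?case
  proof (rule disjE[OF coord_cases[of l]]; elim exE)
    fix i assume "\<forall>z. z $ l = \<pi> z $ i"
    then show ?thesis using tensors.prod[OF poly_funs.coord[of i] poly_funs.const[of 1]] by simp
  next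
    fix j assume "\<forall>z. z $ l = \<rho> z $ j"
    then show ?thesis using tensors.prod[OF poly_funs.const[of 1] poly_funs.coord[of j]] by simp
  qed
qed (auto intro: tensors.sum tensors_mult)

section \<open>Derivations and flows lifted from a factor\<close>

definition slice :: "(complex ^ 'k \<Rightarrow> complex) \<Rightarrow> complex ^ 'm \<Rightarrow> complex ^ 'n \<Rightarrow> complex" where
  "slice f y = (\<lambda>x\<in>X. f (pair x y))"

text \<open>The vector field \<open>h D\<close> along the first factor, with \<open>h\<close> a
  function on the second. Applying \<open>D\<close> slice by slice avoids choosing a representation
  of \<open>f\<close> as a sum of products.\<close>

definition lift where
  "lift h D f = (\<lambda>z\<in>Z. h (\<rho> z) * D (slice f (\<rho> z)) (\<pi> z))"

lemma pair_in_Z [simp]: "pair x y \<in> Z \<longleftrightarrow> x \<in> X \<and> y \<in> Y"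
  by (simp add: mem_Z)

lemma slice_tensor:
  "y \<in> Y \<Longrightarrow> slice (restrict (\<lambda>z. a (\<pi> z) * b (\<rho> z)) Z) y = (\<lambda>x\<in>X. b y * restrict a X x)"
  by (auto simp: slice_def fun_eq_iff restrict_apply)

lemma slice_add:
  "y \<in> Y \<Longrightarrow> slice (\<lambda>z\<in>Z. f z + g z) y = (\<lambda>x\<in>X. slice f y x + slice g y x)"
  by (auto simp: slice_def fun_eq_iff restrict_apply)

lemma slice_mult:
  "y \<in> Y \<Longrightarrow> slice (\<lambda>z\<in>Z. f z * g z) y = (\<lambda>x\<in>X. slice f y x * slice g y x)"
  by (auto simp: slice_def fun_eq_iff restrict_apply)

lemma slice_smult:
  "y \<in> Y \<Longrightarrow> slice (\<lambda>z\<in>Z. c * f z) y = (\<lambda>x\<in>X. c * slice f y x)"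
  by (auto simp: slice_def fun_eq_iff restrict_apply)

lemma slice_restrict_add:
  "y \<in> Y \<Longrightarrow> slice (restrict (\<lambda>z. p z + q z) Z) y =
    (\<lambda>x\<in>X. slice (restrict p Z) y x + slice (restrict q Z) y x)"
  by (auto simp: slice_def fun_eq_iff restrict_apply)

lemma slice_in:
  assumes "f \<in> coordinate_ring Z" "y \<in> Y"
  shows "slice f y \<in> coordinate_ring X"
proof -
  have "slice (restrict p Z) y \<in> coordinate_ring X" if "p \<in> tensors" for p
    using that
  proof induction
    case (prod a b)
    show ?case unfolding slice_tensor[OF \<open>y \<in> Y\<close>]
      by (intro coordinate_ring_smult coordinate_ringI prod)
  next
    case (sum p q)
    then show ?case by (simp add: slice_restrict_add assms coordinate_ring_add)
  qed
  then show ?thesis using assms poly_tensors by (auto simp: coordinate_ring_def)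
qed

text \<open>The result must be polynomial in both variables jointly, not just on each slice. On a
  product, \<open>D\<close> acts on the first factor alone, and a single polynomial
  \<open>a'\<close> representing the derivative of \<open>a\<close> serves all slices; sums follow
  by additivity.\<close>

lemma lift_in:
  assumes D: "derivation X D" and h: "h \<in> poly_funs" and f: "f \<in> coordinate_ring Z"
  shows "lift h D f \<in> coordinate_ring Z"
proof -
  have "lift h D (restrict p Z) \<in> coordinate_ring Z" if "p \<in> tensors" for p
    using that
  proof induction
    case (prod a b)
    obtain a' where a': "a' \<in> poly_funs" "D (restrict a X) = restrict a' X"
      using derivation_in[OF D coordinate_ringI[OF prod(1)]] by (auto simp: coordinate_ring_def)
    have "lift h D (restrict (\<lambda>z. a (\<pi> z) * b (\<rho> z)) Z) =
        restrict (\<lambda>z. h (\<rho> z) * (b (\<rho> z) * a' (\<pi> z))) Z"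
      unfolding lift_def
    proof (rule restrict_ext)
      fix z assume "z \<in> Z"
      then show "h (\<rho> z) * D (slice (restrict (\<lambda>z. a (\<pi> z) * b (\<rho> z)) Z) (\<rho> z)) (\<pi> z) =
          h (\<rho> z) * (b (\<rho> z) * a' (\<pi> z))"
        using slice_tensor[of "\<rho> z" a b] a' derivation_smult[OF D coordinate_ringI[OF prod(1)]]
        by (simp add: mem_Z)
    qed
    then show ?case using h prod a'
      by (auto intro!: coordinate_ringI poly_funs.mult poly_funs_\<pi> poly_funs_\<rho>)
  next
    case (sum p q)
    have "slice (restrict p Z) y \<in> coordinate_ring X" "slice (restrict q Z) y \<in> coordinate_ring X"
      if "y \<in> Y" for y
      using slice_in that sum tensors_poly coordinate_ringI by blast+
    then have "lift h D (restrict (\<lambda>z. p z + q z) Z) =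
        (\<lambda>z\<in>Z. lift h D (restrict p Z) z + lift h D (restrict q Z) z)"
      by (auto simp: lift_def mem_Z slice_restrict_add derivation_add[OF D] distrib_left fun_eq_iff restrict_apply)
    then show ?case using sum by (simp add: coordinate_ring_add)
  qed
  then show ?thesis using f poly_tensors by (auto simp: coordinate_ring_def)
qed

lemma lift_derivation:
  assumes D: "derivation X D" and h: "h \<in> poly_funs"
  shows "derivation Z (lift h D)"
proof -
  note simps = lift_def mem_Z fun_eq_iff restrict_apply slice_in
  \<comment> \<open>Identifies the undifferentiated factors in the Leibniz rule, which appear as
    values of slices after \<open>D\<close> is applied.\<close>
  have "slice f (\<rho> z) (\<pi> z) = f z" if "z \<in> Z" for f z
    using that by (simp add: slice_def mem_Z)
  then show ?thesis
    using lift_in[OF D h] unfolding derivation_def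
    by (auto simp: simps slice_add slice_smult slice_mult derivation_add[OF D] derivation_smult[OF D]
        derivation_mult[OF D] algebra_simps)
qed

text \<open>On a slice \<open>h\<close> is the scalar \<open>h y\<close>, which commutes with
  \<open>D\<close>, so each application contributes one more factor of it.\<close>

lemma lift_funpow:
  assumes D: "derivation X D" and f: "f \<in> coordinate_ring Z"
  shows "(lift h D ^^ k) f = (\<lambda>z\<in>Z. h (\<rho> z) ^ k * (D ^^ k) (slice f (\<rho> z)) (\<pi> z))"
proof (induction k)
  case 0
  \<comment> \<open>Needed for equality off \<open>Z\<close>, where both sides are
    \<open>undefined\<close>.\<close>
  have "f \<in> extensional Z" using f by (auto simp: coordinate_ring_def)
  then show ?case by (auto simp: slice_def mem_Z fun_eq_iff restrict_apply extensional_def)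
next
  case (Suc k)
  have "D (slice ((lift h D ^^ k) f) y) = (\<lambda>x\<in>X. h y ^ k * (D ^^ Suc k) (slice f y) x)"
    if y: "y \<in> Y" for y
  proof -
    have "slice ((lift h D ^^ k) f) y = (\<lambda>x\<in>X. h y ^ k * (D ^^ k) (slice f y) x)"
      unfolding Suc by (subst slice_def) (rule restrict_ext, simp add: y)
    then show ?thesis
      using derivation_smult[OF D derivation_funpow_in[OF D slice_in[OF f y]]] by simp
  qed
  then show ?case
    by (simp add: lift_def[of h D "(lift h D ^^ k) f"] mem_Z mult.assoc cong: restrict_cong)
qed

text \<open>The exponent must not depend on the slice. For a product \<open>a b\<close>, every slice
  is a multiple of \<open>a\<close>, so the exponent of \<open>a\<close> works for all
  \<open>y\<close>; for a sum, the maximum of the two exponents works.\<close>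

lemma lift_LND:
  assumes D: "locally_nilpotent_derivation X D" and h: "h \<in> poly_funs"
  shows "locally_nilpotent_derivation Z (lift h D)"
  unfolding locally_nilpotent_derivation_def
proof (intro conjI ballI)
  have der: "derivation X D" using D by (simp add: locally_nilpotent_derivation_def)
  show "derivation Z (lift h D)" by (rule lift_derivation[OF der h])
  have nil: "\<exists>k. \<forall>y\<in>Y. (D ^^ k) (slice (restrict p Z) y) = (\<lambda>x\<in>X. 0)" if "p \<in> tensors" for p
    using that
  proof induction
    case (prod a b)
    obtain k where "(D ^^ k) (restrict a X) = (\<lambda>x\<in>X. 0)"
      using D coordinate_ringI[OF prod(1), of X] by (auto simp: locally_nilpotent_derivation_def)
    then have "(D ^^ k) (slice (restrict (\<lambda>z. a (\<pi> z) * b (\<rho> z)) Z) y) = (\<lambda>x\<in>X. 0)" if "y \<in> Y" for y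
      using derivation_funpow_smult[OF der coordinate_ringI[OF prod(1)], of k "b y"]
      by (simp only: slice_tensor[OF that]) (auto simp: fun_eq_iff restrict_apply)
    then show ?case by blast
  next
    case (sum p q)
    then obtain k l where kl: "\<forall>y\<in>Y. (D ^^ k) (slice (restrict p Z) y) = (\<lambda>x\<in>X. 0)"
      "\<forall>y\<in>Y. (D ^^ l) (slice (restrict q Z) y) = (\<lambda>x\<in>X. 0)" by blast
    have "(D ^^ max k l) (slice (restrict (\<lambda>z. p z + q z) Z) y) = (\<lambda>x\<in>X. 0)" if y: "y \<in> Y" for y
    proof -
      have "(D ^^ max k l) (slice (restrict p Z) y) = (\<lambda>x\<in>X. 0)"
        "(D ^^ max k l) (slice (restrict q Z) y) = (\<lambda>x\<in>X. 0)"
        using derivation_funpow_zero_mono[OF der] kl y by (meson max.cobounded1 max.cobounded2)+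
      moreover have "slice (restrict p Z) y \<in> coordinate_ring X"
        "slice (restrict q Z) y \<in> coordinate_ring X"
        using slice_in y sum tensors_poly coordinate_ringI by blast+
      ultimately show ?thesis
        by (auto simp: slice_restrict_add y derivation_funpow_add[OF der] fun_eq_iff restrict_apply)
    qed
    then show ?case by blast
  qed
  fix f assume f: "f \<in> coordinate_ring Z"
  then obtain p where "p \<in> poly_funs" "f = restrict p Z" by (auto simp: coordinate_ring_def)
  then obtain k where "\<forall>y\<in>Y. (D ^^ k) (slice f y) = (\<lambda>x\<in>X. 0)"
    using nil[OF poly_tensors] by blast
  then show "\<exists>k. (lift h D ^^ k) f = (\<lambda>z\<in>Z. 0)"
    by (intro exI[of _ k]) (auto simp: lift_funpow[OF der f] mem_Z fun_eq_iff restrict_apply)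
qed

text \<open>The second coordinate does not move, so \<open>h\<close> is constant along each
  trajectory and merely rescales time; the chain rule returns the factor \<open>h y\<close>.\<close>

lemma lift_flow:
  assumes \<phi>: "is_flow X D \<phi>"
  shows "is_flow Z (lift h D) (\<lambda>t z. pair (\<phi> (h (\<rho> z) * t) (\<pi> z)) (\<rho> z))"
  unfolding is_flow_def
proof (intro conjI allI ballI)
  have in_X: "\<phi> t x \<in> X" if "x \<in> X" for t x
    using \<phi> that by (auto simp: is_flow_def)
  show "(\<lambda>z. pair (\<phi> (h (\<rho> z) * t) (\<pi> z)) (\<rho> z)) \<in> Z \<rightarrow> Z" for t
    using in_X by (auto simp: mem_Z)
  show "pair (\<phi> (h (\<rho> z) * 0) (\<pi> z)) (\<rho> z) = z" if "z \<in> Z" for z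
    using \<phi> that by (auto simp: is_flow_def mem_Z)
  fix f z t assume f: "f \<in> coordinate_ring Z" and z: "z \<in> Z"
  let ?x = "\<pi> z" and ?y = "\<rho> z"
  have xy: "?x \<in> X" "?y \<in> Y" using z by (auto simp: mem_Z)
  have "((\<lambda>s. slice f ?y (\<phi> s ?x)) has_field_derivative
      D (slice f ?y) (\<phi> (h ?y * t) ?x)) (at (h ?y * t))"
    using \<phi> slice_in[OF f] xy by (auto simp: is_flow_def)
  then have "((\<lambda>s. slice f ?y (\<phi> (h ?y * s) ?x)) has_field_derivative
      D (slice f ?y) (\<phi> (h ?y * t) ?x) * h ?y) (at t)"
    by (rule DERIV_chain2) (auto intro!: derivative_eq_intros)
  then show "((\<lambda>s. f (pair (\<phi> (h ?y * s) ?x) ?y)) has_field_derivative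
      lift h D f (pair (\<phi> (h ?y * t) ?x) ?y)) (at t)"
    using in_X xy by (simp add: slice_def lift_def mult.commute)
qed

lemma lift_flow_in_flow_group:
  assumes "lift h D \<in> U" "is_flow X D \<phi>"
  shows "\<exists>\<gamma>\<in>flow_group Z U. \<forall>z\<in>Z. \<gamma> z = pair (\<phi> (h (\<rho> z) * t) (\<pi> z)) (\<rho> z)"
  by (rule bexI[OF _ flow_in_flow_group[OF assms(1) lift_flow[OF assms(2)], of t]]) simp

text \<open>Letting an element act on the first coordinate alone respects composition, so lifting
  the generating flows suffices. In the applications these lifts come from \<open>lift\<close> with
  \<open>h\<close> equal to 1.\<close>

lemma lift_flow_group:
  assumes S: "\<forall>D\<in>S. locally_nilpotent_derivation X D" and G: "subgroup G (BijGroup Z)"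
    and flow: "\<And>D \<phi> t. D \<in> S \<Longrightarrow> is_flow X D \<phi> \<Longrightarrow>
      \<exists>\<gamma>\<in>G. \<forall>z\<in>Z. \<gamma> z = pair (\<phi> t (\<pi> z)) (\<rho> z)"
    and g: "g \<in> flow_group X S"
  shows "\<exists>\<gamma>\<in>G. \<forall>z\<in>Z. \<gamma> z = pair (g (\<pi> z)) (\<rho> z)"
  using S g
proof (induction rule: flow_group_induct)
  case id
  then show ?case using subgroup_BijGroup_id[OF G] by (auto simp: mem_Z)
next
  case (flow D \<phi> t)
  obtain \<gamma> where "\<gamma> \<in> G" "\<forall>z\<in>Z. \<gamma> z = pair (\<phi> t (\<pi> z)) (\<rho> z)"
    using assms(3)[OF flow] by blast
  then show ?case by (intro bexI[of _ \<gamma>]) (simp_all add: mem_Z)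
next
  case (compose f g)
  then obtain \<gamma> \<delta> where \<gamma>\<delta>: "\<gamma> \<in> G" "\<delta> \<in> G" and
    fg: "\<forall>z\<in>Z. \<gamma> z = pair (f (\<pi> z)) (\<rho> z)" "\<forall>z\<in>Z. \<delta> z = pair (g (\<pi> z)) (\<rho> z)" by blast
  obtain \<epsilon> where \<epsilon>: "\<epsilon> \<in> G" "\<forall>z\<in>Z. \<epsilon> z = \<gamma> (\<delta> z)"
    using subgroup_BijGroup_compose[OF G \<gamma>\<delta>] by blast
  have "g x \<in> X" if "x \<in> X" for x
    using compose(2) that by (auto simp: Bij_def bij_betw_def)
  then have "\<epsilon> z = pair (compose X f g (\<pi> z)) (\<rho> z)" if "z \<in> Z" for z
    using that \<epsilon> fg by (simp add: mem_Z compose_def)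
  with \<epsilon>(1) show ?case by blast
qed

section \<open>Independent motion of finitely many fibres\<close>

context
  fixes G and S and T and h :: "complex ^ 'm \<Rightarrow> complex" and a b :: "complex ^ 'm"
  assumes S: "\<forall>D\<in>S. locally_nilpotent_derivation X D"
    and T: "\<forall>D\<in>T. locally_nilpotent_derivation Y D"
    and G: "subgroup G (BijGroup Z)"
    and vertical: "\<And>g. g \<in> flow_group Y T \<Longrightarrow> \<exists>\<gamma>\<in>G. \<forall>z\<in>Z. \<gamma> z = pair (\<pi> z) (g (\<rho> z))"
    and shear: "\<And>D \<phi> t. D \<in> S \<Longrightarrow> is_flow X D \<phi> \<Longrightarrow>
      \<exists>\<gamma>\<in>G. \<forall>z\<in>Z. \<gamma> z = pair (\<phi> (h (\<rho> z) * t) (\<pi> z)) (\<rho> z)"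
    and trY: "infinitely_transitive Y (flow_group Y T)"
    and h: "a \<in> Y" "b \<in> Y" "h a \<noteq> h b"
begin

text \<open>Conjugation by the lift of \<open>g\<close> to the second coordinate replaces
  \<open>h\<close> by \<open>h\<close> after \<open>g\<close>. Infinitely many shears thus arise
  from one function \<open>h\<close>, which is why finitely many derivations suffice.\<close>

lemma conjugate_shear:
  assumes D: "D \<in> S" and \<phi>: "is_flow X D \<phi>" and g: "g \<in> flow_group Y T"
  shows "\<exists>\<gamma>\<in>G. \<forall>z\<in>Z. \<gamma> z = pair (\<phi> (h (g (\<rho> z)) * t) (\<pi> z)) (\<rho> z)"
proof -
  obtain \<gamma> where \<gamma>: "\<gamma> \<in> G" "\<forall>z\<in>Z. \<gamma> z = pair (\<pi> z) (g (\<rho> z))"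
    using vertical[OF g] by blast
  obtain \<gamma>' where \<gamma>': "\<gamma>' \<in> G" "\<forall>z\<in>Z. \<gamma>' (\<gamma> z) = z"
    using subgroup_BijGroup_inverse[OF G \<gamma>(1)] by blast
  obtain \<sigma> where \<sigma>: "\<sigma> \<in> G" "\<forall>z\<in>Z. \<sigma> z = pair (\<phi> (h (\<rho> z) * t) (\<pi> z)) (\<rho> z)"
    using shear[OF D \<phi>] by blast
  obtain \<delta> where \<delta>: "\<delta> \<in> G" "\<forall>z\<in>Z. \<delta> z = \<sigma> (\<gamma> z)"
    using subgroup_BijGroup_compose[OF G \<sigma>(1) \<gamma>(1)] by blast
  obtain \<epsilon> where \<epsilon>: "\<epsilon> \<in> G" "\<forall>z\<in>Z. \<epsilon> z = \<gamma>' (\<delta> z)"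
    using subgroup_BijGroup_compose[OF G \<gamma>'(1) \<delta>(1)] by blast
  have "\<epsilon> z = pair (\<phi> (h (g (\<rho> z)) * t) (\<pi> z)) (\<rho> z)" if z: "z \<in> Z" for z
  proof -
    let ?w = "pair (\<phi> (h (g (\<rho> z)) * t) (\<pi> z)) (\<rho> z)"
    have w: "?w \<in> Z" using \<phi> z by (auto simp: is_flow_def mem_Z)
    have "pair (\<pi> z) (g (\<rho> z)) \<in> Z"
      using \<gamma>(2) z subgroup_BijGroup_mem[OF G \<gamma>(1) z] by simp
    \<comment> \<open>Moving to the fibre over \<open>g (\<rho> z)\<close> and shearing there equals
      shearing first with the rescaled time and then moving; undoing the move leaves
      \<open>?w\<close>.\<close>
    then have "\<delta> z = \<gamma> ?w"
      using w z \<gamma>(2) \<sigma>(2) \<delta>(2) by simp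
    then show ?thesis using \<epsilon>(2) \<gamma>'(2) w z by simp
  qed
  with \<epsilon>(1) show ?thesis by blast
qed

text \<open>
  Two conjugates of a shear whose conjugating elements agree on all of \<open>B\<close> except at \<open>\<eta>\<close> differ by
  a flow on the fibre over \<open>\<eta>\<close>, with a time proportional to \<open>h a - h b \<noteq> 0\<close>.
\<close>

lemma act_on_fibre:
  assumes B: "finite B" "B \<subseteq> Y" "\<eta> \<in> B" and g: "g \<in> flow_group X S"
  shows "\<exists>\<gamma>\<in>G. \<forall>z\<in>Z. \<rho> z \<in> B \<longrightarrow> \<gamma> z = pair (if \<rho> z = \<eta> then g (\<pi> z) else \<pi> z) (\<rho> z)"
  using S g
proof (induction rule: flow_group_induct)
  case id
  obtain \<gamma> where "\<gamma> \<in> G" "\<forall>z\<in>Z. \<gamma> z = z"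
    using subgroup_BijGroup_id[OF G] by blast
  then show ?case by (intro bexI[of _ \<gamma>]) (auto simp: mem_Z)
next
  case (flow D \<phi> t)
  have D: "locally_nilpotent_derivation X D" using S flow by blast
  \<comment> \<open>Room to park the points of \<open>B\<close> other than \<open>\<eta>\<close>
    away from \<open>a\<close> and \<open>b\<close>, so that \<open>\<eta>\<close> can be sent to
    either of these while the assignment stays injective.\<close>
  have "infinite (Y - {a, b})"
    using infinite_if_flow_group_transitive[OF T trY h(1,2)] h(3) by auto
  then obtain C where C: "finite C" "card C = card (B - {\<eta>})" "C \<subseteq> Y - {a, b}"
    by (metis infinite_arbitrarily_large)
  then obtain v where v: "bij_betw v (B - {\<eta>}) C"
    using B finite_same_card_bij[of "B - {\<eta>}" C] by auto
  have moving: "\<exists>g\<in>flow_group Y T. \<forall>y\<in>B. g y = (if y = \<eta> then c else v y)" if "c \<in> {a, b}" for c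
  proof (rule infinitely_transitive_finite_family[OF trY B(1), of "\<lambda>y. y", simplified])
    show "inj_on (\<lambda>y. if y = \<eta> then c else v y) B"
      using v C that by (auto simp: bij_betw_def inj_on_def)
    show "(\<lambda>y. if y = \<eta> then c else v y) ` B \<subseteq> Y"
      using v C that h by (auto simp: bij_betw_def)
  qed (use B in auto)
  obtain ga where ga: "ga \<in> flow_group Y T" "\<forall>y\<in>B. ga y = (if y = \<eta> then a else v y)"
    using moving[of a] by auto
  obtain gb where gb: "gb \<in> flow_group Y T" "\<forall>y\<in>B. gb y = (if y = \<eta> then b else v y)"
    using moving[of b] by auto
  \<comment> \<open>Normalizes the net time over \<open>\<eta>\<close>, which is
    \<open>(h a - h b) * ?s\<close>, to \<open>t\<close>. Over the other points of \<open>B\<close>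
    the two times cancel.\<close>
  let ?s = "t / (h a - h b)"
  obtain \<gamma> where \<gamma>: "\<gamma> \<in> G" "\<forall>z\<in>Z. \<gamma> z = pair (\<phi> (h (ga (\<rho> z)) * ?s) (\<pi> z)) (\<rho> z)"
    using conjugate_shear[OF flow ga(1)] by blast
  obtain \<delta> where \<delta>: "\<delta> \<in> G" "\<forall>z\<in>Z. \<delta> z = pair (\<phi> (h (gb (\<rho> z)) * - ?s) (\<pi> z)) (\<rho> z)"
    using conjugate_shear[OF flow gb(1)] by blast
  obtain \<epsilon> where \<epsilon>: "\<epsilon> \<in> G" "\<forall>z\<in>Z. \<epsilon> z = \<gamma> (\<delta> z)"
    using subgroup_BijGroup_compose[OF G \<gamma>(1) \<delta>(1)] by blast
  have "\<epsilon> z = pair (if \<rho> z = \<eta> then restrict (\<phi> t) X (\<pi> z) else \<pi> z) (\<rho> z)"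
    if z: "z \<in> Z" "\<rho> z \<in> B" for z
  proof -
    have x: "\<pi> z \<in> X" using z by (simp add: mem_Z)
    have "pair (\<phi> (h (gb (\<rho> z)) * - ?s) (\<pi> z)) (\<rho> z) \<in> Z"
      using z(1) \<delta>(2) subgroup_BijGroup_mem[OF G \<delta>(1) z(1)] by simp
    then have "\<epsilon> z = pair (\<phi> ((h (ga (\<rho> z)) - h (gb (\<rho> z))) * ?s) (\<pi> z)) (\<rho> z)"
      using z \<gamma>(2) \<delta>(2) \<epsilon>(2) flow_add[OF D flow(2) x] by (simp add: algebra_simps diff_divide_distrib)
    moreover have "(h (ga (\<rho> z)) - h (gb (\<rho> z))) * ?s = (if \<rho> z = \<eta> then t else 0)"
      using ga gb z h by simp
    ultimately show ?thesis
      using flow(2) x by (auto simp: is_flow_def)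
  qed
  with \<epsilon>(1) show ?case by blast
next
  case (compose f g)
  then obtain \<gamma> \<delta> where \<gamma>: "\<gamma> \<in> G"
      "\<forall>z\<in>Z. \<rho> z \<in> B \<longrightarrow> \<gamma> z = pair (if \<rho> z = \<eta> then f (\<pi> z) else \<pi> z) (\<rho> z)"
    and \<delta>: "\<delta> \<in> G"
      "\<forall>z\<in>Z. \<rho> z \<in> B \<longrightarrow> \<delta> z = pair (if \<rho> z = \<eta> then g (\<pi> z) else \<pi> z) (\<rho> z)"
    by blast
  obtain \<epsilon> where \<epsilon>: "\<epsilon> \<in> G" "\<forall>z\<in>Z. \<epsilon> z = \<gamma> (\<delta> z)"
    using subgroup_BijGroup_compose[OF G \<gamma>(1) \<delta>(1)] by blast
  have "g x \<in> X" if "x \<in> X" for x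
    using compose(2) that by (auto simp: Bij_def bij_betw_def)
  then have "\<epsilon> z = pair (if \<rho> z = \<eta> then compose X f g (\<pi> z) else \<pi> z) (\<rho> z)"
    if "z \<in> Z" "\<rho> z \<in> B" for z
    using that \<epsilon>(2) \<gamma>(2) \<delta>(2) by (auto simp: mem_Z compose_def)
  with \<epsilon>(1) show ?case by blast
qed

text \<open>The fibres are treated one at a time by \<open>act_on_fibre\<close>, always relative to
  all of \<open>B\<close>: each new factor fixes the remaining fibres over \<open>B\<close>
  pointwise, so it neither spoils the finished ones nor disturbs those still to come.\<close>

lemma act_on_fibres:
  assumes B: "finite B" "B \<subseteq> Y" and g: "\<And>\<eta>. \<eta> \<in> B \<Longrightarrow> g \<eta> \<in> flow_group X S"
  shows "\<exists>\<gamma>\<in>G. \<forall>z\<in>Z. \<rho> z \<in> B \<longrightarrow> \<gamma> z = pair (g (\<rho> z) (\<pi> z)) (\<rho> z)"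
proof -
  have "\<exists>\<gamma>\<in>G. \<forall>z\<in>Z. \<rho> z \<in> B \<longrightarrow> \<gamma> z = pair (if \<rho> z \<in> A then g (\<rho> z) (\<pi> z) else \<pi> z) (\<rho> z)"
    if "finite A" "A \<subseteq> B" for A
    using that
  proof (induction A)
    case empty
    then show ?case using subgroup_BijGroup_id[OF G] by auto
  next
    case (insert \<eta> A)
    then obtain \<delta> where \<delta>: "\<delta> \<in> G"
      "\<forall>z\<in>Z. \<rho> z \<in> B \<longrightarrow> \<delta> z = pair (if \<rho> z \<in> A then g (\<rho> z) (\<pi> z) else \<pi> z) (\<rho> z)" by auto
    obtain \<gamma> where \<gamma>: "\<gamma> \<in> G"
      "\<forall>z\<in>Z. \<rho> z \<in> B \<longrightarrow> \<gamma> z = pair (if \<rho> z = \<eta> then g \<eta> (\<pi> z) else \<pi> z) (\<rho> z)"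
      using act_on_fibre[OF B, of \<eta> "g \<eta>"] g insert.prems by auto
    obtain \<epsilon> where \<epsilon>: "\<epsilon> \<in> G" "\<forall>z\<in>Z. \<epsilon> z = \<gamma> (\<delta> z)"
      using subgroup_BijGroup_compose[OF G \<gamma>(1) \<delta>(1)] by blast
    have "\<epsilon> z = pair (if \<rho> z \<in> insert \<eta> A then g (\<rho> z) (\<pi> z) else \<pi> z) (\<rho> z)"
      if z: "z \<in> Z" "\<rho> z \<in> B" for z
      using subgroup_BijGroup_mem[OF G \<delta>(1) z(1)] z \<epsilon>(2) \<gamma>(2) \<delta>(2) insert.hyps by auto
    with \<epsilon>(1) show ?case by blast
  qed
  from this[of B] B show ?thesis by auto
qed

end

section \<open>Normal form of tuples and transitivity on the product\<close>

text \<open>First the points are moved within their fibres over \<open>Y\<close> until their first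
  coordinates are the distinct \<open>\<xi> i\<close>. Then each lies alone in its fibre over
  \<open>X\<close> among the points of the tuple, so the second coordinates can be moved to
  \<open>\<upsilon>\<close> independently.\<close>

lemma separate_and_collapse:
  assumes G: "subgroup G (BijGroup Z)"
    and X: "infinitely_transitive X H" and Y: "infinitely_transitive Y K"
    and act_X: "\<And>B g. finite B \<Longrightarrow> B \<subseteq> Y \<Longrightarrow> (\<And>y. y \<in> B \<Longrightarrow> g y \<in> H) \<Longrightarrow>
      \<exists>\<gamma>\<in>G. \<forall>z\<in>Z. \<rho> z \<in> B \<longrightarrow> \<gamma> z = pair (g (\<rho> z) (\<pi> z)) (\<rho> z)"
    and act_Y: "\<And>B g. finite B \<Longrightarrow> B \<subseteq> X \<Longrightarrow> (\<And>x. x \<in> B \<Longrightarrow> g x \<in> K) \<Longrightarrow>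
      \<exists>\<gamma>\<in>G. \<forall>z\<in>Z. \<pi> z \<in> B \<longrightarrow> \<gamma> z = pair (\<pi> z) (g (\<pi> z) (\<rho> z))"
    and I: "finite I" and u: "inj_on u I" "u ` I \<subseteq> Z"
    and \<xi>: "inj_on \<xi> I" "\<xi> ` I \<subseteq> X" and \<upsilon>: "\<upsilon> \<in> Y"
  shows "\<exists>\<gamma>\<in>G. \<forall>i\<in>I. \<gamma> (u i) = pair (\<xi> i) \<upsilon>"
proof -
  have u_Z: "\<pi> (u i) \<in> X" "\<rho> (u i) \<in> Y" "u i \<in> Z" if "i \<in> I" for i
    using u(2) that by (auto simp: mem_Z)
  \<comment> \<open>Points with the same second coordinate \<open>y\<close> have distinct first
    coordinates, because \<open>u\<close> is injective. If no point lies over \<open>y\<close>, the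
    family is empty, so \<open>g\<close> can be chosen for every \<open>y\<close>.\<close>
  have "\<exists>g\<in>H. \<forall>i\<in>{i\<in>I. \<rho> (u i) = y}. g (\<pi> (u i)) = \<xi> i" for y
  proof (rule infinitely_transitive_finite_family[OF X])
    show "inj_on (\<lambda>i. \<pi> (u i)) {i \<in> I. \<rho> (u i) = y}"
      using u(1) by (auto simp: inj_on_def) (metis pair_surj)
  qed (use I \<xi> u_Z in \<open>auto intro: inj_on_subset\<close>)
  then obtain g where g: "\<And>y. g y \<in> H" "\<And>i. i \<in> I \<Longrightarrow> g (\<rho> (u i)) (\<pi> (u i)) = \<xi> i"
    by (metis (mono_tags, lifting) mem_Collect_eq)
  obtain \<gamma> where \<gamma>: "\<gamma> \<in> G" "\<forall>z\<in>Z. \<rho> z \<in> (\<lambda>i. \<rho> (u i)) ` I \<longrightarrow> \<gamma> z = pair (g (\<rho> z) (\<pi> z)) (\<rho> z)"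
    using act_X[of "(\<lambda>i. \<rho> (u i)) ` I" g] I u_Z g(1) by auto
  have \<gamma>_u: "\<gamma> (u i) = pair (\<xi> i) (\<rho> (u i))" if "i \<in> I" for i
    using \<gamma>(2) u_Z[OF that] g(2)[OF that] that by auto
  have "\<exists>k\<in>K. k (\<rho> (u i)) = \<upsilon>" if "i \<in> I" for i
    using infinitely_transitive_finite_family[OF Y, of "{i}" "\<lambda>i. \<rho> (u i)" "\<lambda>_. \<upsilon>"] u_Z[OF that] \<upsilon> by auto
  then obtain k where k: "\<And>i. i \<in> I \<Longrightarrow> k i \<in> K" "\<And>i. i \<in> I \<Longrightarrow> k i (\<rho> (u i)) = \<upsilon>" by metis
  \<comment> \<open>Since the \<open>\<xi> i\<close> are distinct, the index of a point can be read
    off from its first coordinate, which selects the element \<open>k i\<close> to apply.\<close>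
  have "\<exists>\<delta>\<in>G. \<forall>z\<in>Z. \<pi> z \<in> \<xi> ` I \<longrightarrow> \<delta> z = pair (\<pi> z) (k (inv_into I \<xi> (\<pi> z)) (\<rho> z))"
    using I \<xi> k(1) by (intro act_Y) (auto simp: inv_into_f_f)
  then obtain \<delta> where \<delta>: "\<delta> \<in> G"
    "\<forall>z\<in>Z. \<pi> z \<in> \<xi> ` I \<longrightarrow> \<delta> z = pair (\<pi> z) (k (inv_into I \<xi> (\<pi> z)) (\<rho> z))" by blast
  obtain \<epsilon> where \<epsilon>: "\<epsilon> \<in> G" "\<forall>z\<in>Z. \<epsilon> z = \<delta> (\<gamma> z)"
    using subgroup_BijGroup_compose[OF G \<delta>(1) \<gamma>(1)] by blast
  have "\<epsilon> (u i) = pair (\<xi> i) \<upsilon>" if i: "i \<in> I" for i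
    using \<epsilon>(2) \<delta>(2) u_Z[OF i] \<gamma>_u[OF i] \<xi> i k(2)[OF i] by (simp add: inv_into_f_f image_subset_iff)
  with \<epsilon>(1) show ?thesis by blast
qed

text \<open>Both tuples are brought to the same form, and one of the two moves is inverted. The
  infinite set \<open>X\<close> supplies a single sequence \<open>\<xi>\<close> whose initial
  segments serve all lengths \<open>m\<close>.\<close>

lemma infinitely_transitive_if_common_form:
  assumes G: "subgroup G (BijGroup Z)" and "infinite X" "\<upsilon> \<in> Y"
    and form: "\<And>(I :: nat set) u \<xi>. finite I \<Longrightarrow> inj_on u I \<Longrightarrow> u ` I \<subseteq> Z \<Longrightarrow> inj_on \<xi> I \<Longrightarrow>
      \<xi> ` I \<subseteq> X \<Longrightarrow> \<exists>\<gamma>\<in>G. \<forall>i\<in>I. \<gamma> (u i) = pair (\<xi> i) \<upsilon>"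
  shows "infinitely_transitive Z G"
  unfolding infinitely_transitive_def m_transitive_def
proof (intro allI impI; elim conjE)
  fix m zs ws
  assume zs: "length zs = m" "distinct zs" "set zs \<subseteq> Z" and ws: "length ws = m" "distinct ws" "set ws \<subseteq> Z"
  obtain \<xi> :: "nat \<Rightarrow> complex ^ 'n" where \<xi>: "inj \<xi>" "range \<xi> \<subseteq> X"
    using infinite_countable_subset[OF \<open>infinite X\<close>] by blast
  have ex: "\<exists>\<gamma>\<in>G. \<forall>i\<in>{..<m}. \<gamma> (vs ! i) = pair (\<xi> i) \<upsilon>"
    if "length vs = m" "distinct vs" "set vs \<subseteq> Z" for vs
  proof (rule form)
    show "inj_on ((!) vs) {..<m}" using that by (auto simp: inj_on_def nth_eq_iff_index_eq)
    show "inj_on \<xi> {..<m}" using \<xi>(1) by (rule inj_on_subset) simp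
  qed (use that \<xi> in auto)
  obtain \<gamma> \<delta> where \<gamma>: "\<gamma> \<in> G" "\<forall>i\<in>{..<m}. \<gamma> (zs ! i) = pair (\<xi> i) \<upsilon>"
    and \<delta>: "\<delta> \<in> G" "\<forall>i\<in>{..<m}. \<delta> (ws ! i) = pair (\<xi> i) \<upsilon>"
    using ex[OF zs] ex[OF ws] by blast
  obtain \<delta>' where \<delta>': "\<delta>' \<in> G" "\<forall>z\<in>Z. \<delta>' (\<delta> z) = z"
    using subgroup_BijGroup_inverse[OF G \<delta>(1)] by blast
  obtain \<epsilon> where \<epsilon>: "\<epsilon> \<in> G" "\<forall>z\<in>Z. \<epsilon> z = \<delta>' (\<gamma> z)"
    using subgroup_BijGroup_compose[OF G \<delta>'(1) \<gamma>(1)] by blast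
  have "\<epsilon> (zs ! i) = ws ! i" if i: "i < m" for i
  proof -
    have "zs ! i \<in> Z" "ws ! i \<in> Z" using zs ws i nth_mem[of i zs] nth_mem[of i ws] by auto
    moreover have "\<gamma> (zs ! i) = \<delta> (ws ! i)" using \<gamma>(2) \<delta>(2) i by simp
    ultimately show ?thesis using \<epsilon>(2) \<delta>'(2) by simp
  qed
  then have "map \<epsilon> zs = ws" using zs ws by (intro nth_equalityI) auto
  with \<epsilon>(1) show "\<exists>g\<in>G. map g zs = ws" by blast
qed

text \<open>With at most one point in \<open>X\<close>, a point of \<open>Z\<close> is determined by
  its second coordinate, so lifting the derivations of \<open>Y\<close> with factor 1 suffices. The
  case of empty \<open>X\<close> is included.\<close>

lemma finitely_many_LNDs_if_singleton_factor:
  assumes X: "\<And>x x'. x \<in> X \<Longrightarrow> x' \<in> X \<Longrightarrow> x = x'"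
    and "finitely_many_LNDs_infinitely_transitive Y"
  shows "finitely_many_LNDs_infinitely_transitive Z"
proof -
  interpret flip: product_coordinates \<rho> \<pi> "\<lambda>y x. pair x y" Y X Z by (rule flip)
  obtain T where T: "finite T" "\<forall>D\<in>T. locally_nilpotent_derivation Y D"
    "infinitely_transitive Y (flow_group Y T)"
    using assms(2) by (auto simp: finitely_many_LNDs_infinitely_transitive_def)
  let ?U = "flip.lift (\<lambda>_. 1) ` T"
  have U: "\<forall>D\<in>?U. locally_nilpotent_derivation Z D"
    using T(2) by (auto intro!: flip.lift_LND poly_funs.const)
  have "m_transitive m Z (flow_group Z ?U)" for m
    unfolding m_transitive_def
  proof (intro allI impI; elim conjE)
    fix zs ws
    assume zs: "length zs = m" "distinct zs" "set zs \<subseteq> Z" and ws: "length ws = m" "distinct ws" "set ws \<subseteq> Z"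
    have eq: "z = w" if "z \<in> Z" "w \<in> Z" "\<rho> z = \<rho> w" for z w
      using that X[of "\<pi> z" "\<pi> w"] by (metis mem_Z pair_surj)
    have "inj_on \<rho> Z" using eq by (auto intro: inj_onI)
    then have "inj_on (\<lambda>i. \<rho> (vs ! i)) {..<m}"
      if "length vs = m" "distinct vs" "set vs \<subseteq> Z" for vs
      using that by (auto simp: inj_on_def nth_eq_iff_index_eq subset_iff)
        (metis nth_eq_iff_index_eq nth_mem)
    moreover have "(\<lambda>i. \<rho> (vs ! i)) ` {..<m} \<subseteq> Y" if "length vs = m" "set vs \<subseteq> Z" for vs
      using that by (auto simp: mem_Z subset_iff)
    ultimately obtain g where g: "g \<in> flow_group Y T" "\<forall>i\<in>{..<m}. g (\<rho> (zs ! i)) = \<rho> (ws ! i)"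
      using infinitely_transitive_finite_family[OF T(3) finite_lessThan,
          of "\<lambda>i. \<rho> (zs ! i)" m "\<lambda>i. \<rho> (ws ! i)"] zs ws by blast
    have "\<exists>\<gamma>\<in>flow_group Z ?U. \<forall>z\<in>Z. \<gamma> z = pair (\<pi> z) (\<psi> t (\<rho> z))"
      if "D \<in> T" "is_flow Y D \<psi>" for D \<psi> t
      using flip.lift_flow_in_flow_group[of "\<lambda>_. 1" D ?U \<psi> t] that by auto
    then obtain \<gamma> where \<gamma>: "\<gamma> \<in> flow_group Z ?U" "\<forall>z\<in>Z. \<gamma> z = pair (\<pi> z) (g (\<rho> z))"
      using flip.lift_flow_group[OF T(2) subgroup_flow_group[OF U] _ g(1)] by blast
    have "\<gamma> (zs ! i) = ws ! i" if i: "i < m" for i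
    proof -
      have Z: "zs ! i \<in> Z" "ws ! i \<in> Z" using zs ws i nth_mem[of i zs] nth_mem[of i ws] by auto
      have "\<gamma> (zs ! i) = pair (\<pi> (zs ! i)) (\<rho> (ws ! i))"
        using \<gamma>(2) g(2) i Z(1) by simp
      then show ?thesis
        using subgroup_BijGroup_mem[OF subgroup_flow_group[OF U] \<gamma>(1) Z(1)] Z(2) by (intro eq) simp_all
    qed
    then have "map \<gamma> zs = ws" using zs ws by (intro nth_equalityI) auto
    with \<gamma>(1) show "\<exists>g\<in>flow_group Z ?U. map g zs = ws" by blast
  qed
  then show ?thesis
    using U T(1) unfolding finitely_many_LNDs_infinitely_transitive_def infinitely_transitive_def
    by (intro exI[of _ ?U]) simp
qed

lemma finitely_many_LNDs_product:
  assumes X: "finitely_many_LNDs_infinitely_transitive X"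
    and Y: "finitely_many_LNDs_infinitely_transitive Y"
  shows "finitely_many_LNDs_infinitely_transitive Z"
proof -
  interpret flip: product_coordinates \<rho> \<pi> "\<lambda>y x. pair x y" Y X Z by (rule flip)
  show ?thesis
  proof (cases "(\<exists>a\<in>X. \<exists>b\<in>X. a \<noteq> b) \<and> (\<exists>a\<in>Y. \<exists>b\<in>Y. a \<noteq> b)")
    case False
    then show ?thesis
      using finitely_many_LNDs_if_singleton_factor[OF _ Y]
        flip.finitely_many_LNDs_if_singleton_factor[OF _ X] by blast
  next
    case True
    then obtain a b c d where ab: "a \<in> X" "b \<in> X" "a \<noteq> b" and cd: "c \<in> Y" "d \<in> Y" "c \<noteq> d" by blast
    \<comment> \<open>A coordinate that separates two points of a factor is the nonconstant regular
      function used for shears along the other factor.\<close>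
    obtain i j where i: "a $ i \<noteq> b $ i" and j: "c $ j \<noteq> d $ j"
      using ab(3) cd(3) by (auto simp: vec_eq_iff)
    obtain S where S: "finite S" "\<forall>D\<in>S. locally_nilpotent_derivation X D"
      "infinitely_transitive X (flow_group X S)"
      using X by (auto simp: finitely_many_LNDs_infinitely_transitive_def)
    obtain T where T: "finite T" "\<forall>D\<in>T. locally_nilpotent_derivation Y D"
      "infinitely_transitive Y (flow_group Y T)"
      using Y by (auto simp: finitely_many_LNDs_infinitely_transitive_def)
    let ?p = "\<lambda>x. x $ i" and ?q = "\<lambda>y. y $ j"
    \<comment> \<open>For each factor there are two kinds of lifts: those with factor 1 give the
      action of its group on one coordinate, needed for conjugation, and those with
      \<open>?q\<close> or \<open>?p\<close> give the shears.\<close>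
    define U where "U = lift (\<lambda>_. 1) ` S \<union> lift ?q ` S \<union> flip.lift (\<lambda>_. 1) ` T \<union> flip.lift ?p ` T"
    let ?G = "flow_group Z U"
    have U: "\<forall>D\<in>U. locally_nilpotent_derivation Z D"
      using S(2) T(2) by (auto simp: U_def intro!: lift_LND flip.lift_LND poly_funs.const poly_funs.coord)
    have G: "subgroup ?G (BijGroup Z)" by (rule subgroup_flow_group[OF U])
    have "\<exists>\<gamma>\<in>?G. \<forall>z\<in>Z. \<gamma> z = pair (\<phi> t (\<pi> z)) (\<rho> z)"
      if "D \<in> S" "is_flow X D \<phi>" for D \<phi> t
      using lift_flow_in_flow_group[of "\<lambda>_. 1" D U \<phi> t] that by (auto simp: U_def)
    then have horizontal: "\<exists>\<gamma>\<in>?G. \<forall>z\<in>Z. \<gamma> z = pair (g (\<pi> z)) (\<rho> z)" if "g \<in> flow_group X S" for g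
      using lift_flow_group[OF S(2) G _ that] by blast
    have "\<exists>\<gamma>\<in>?G. \<forall>z\<in>Z. \<gamma> z = pair (\<pi> z) (\<psi> t (\<rho> z))"
      if "D \<in> T" "is_flow Y D \<psi>" for D \<psi> t
      using flip.lift_flow_in_flow_group[of "\<lambda>_. 1" D U \<psi> t] that by (auto simp: U_def)
    then have vertical: "\<exists>\<gamma>\<in>?G. \<forall>z\<in>Z. \<gamma> z = pair (\<pi> z) (g (\<rho> z))" if "g \<in> flow_group Y T" for g
      using flip.lift_flow_group[OF T(2) G _ that] by blast
    have shear_X: "\<exists>\<gamma>\<in>?G. \<forall>z\<in>Z. \<gamma> z = pair (\<phi> (?q (\<rho> z) * t) (\<pi> z)) (\<rho> z)"
      if "D \<in> S" "is_flow X D \<phi>" for D \<phi> t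
      using lift_flow_in_flow_group[of ?q D U \<phi> t] that by (auto simp: U_def)
    have shear_Y: "\<exists>\<gamma>\<in>?G. \<forall>z\<in>Z. \<gamma> z = pair (\<pi> z) (\<psi> (?p (\<pi> z) * t) (\<rho> z))"
      if "D \<in> T" "is_flow Y D \<psi>" for D \<psi> t
      using flip.lift_flow_in_flow_group[of ?p D U \<psi> t] that by (auto simp: U_def)
    note act_X = act_on_fibres[where h = ?q, OF S(2) T(2) G vertical shear_X T(3) cd(1,2) j]
    note act_Y = flip.act_on_fibres[where h = ?p, OF T(2) S(2) G horizontal shear_Y S(3) ab(1,2) i]
    have "\<exists>\<gamma>\<in>?G. \<forall>i\<in>I. \<gamma> (u i) = pair (\<xi> i) c"
      if "finite I" "inj_on u I" "u ` I \<subseteq> Z" "inj_on \<xi> I" "\<xi> ` I \<subseteq> X" for I :: "nat set" and u \<xi>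
      by (rule separate_and_collapse[OF G S(3) T(3) act_X act_Y that cd(1)])
    then have "infinitely_transitive Z ?G"
      by (rule infinitely_transitive_if_common_form[OF G
            infinite_if_flow_group_transitive[OF S(2,3) ab] cd(1)])
    moreover have "finite U" using S(1) T(1) by (simp add: U_def)
    ultimately show ?thesis
      using U unfolding finitely_many_LNDs_infinitely_transitive_def by blast
  qed
qed

end

section \<open>The affine product as an instance\<close>

lemma product_coordinates_affine_product:
  fixes X :: "(complex ^ 'n) set" and Y :: "(complex ^ 'm) set"
  shows "product_coordinates (\<lambda>z. \<chi> i. z $ Inl i) (\<lambda>z. \<chi> j. z $ Inr j)
    (\<lambda>x y. \<chi> l. case l of Inl i \<Rightarrow> x $ i | Inr j \<Rightarrow> y $ j) X Y (affine_product X Y)"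
proof
  fix l :: "'n + 'm"
  show "(\<exists>i. \<forall>z :: complex ^ ('n + 'm). z $ l = (\<chi> i. z $ Inl i) $ i) \<or>
      (\<exists>j. \<forall>z :: complex ^ ('n + 'm). z $ l = (\<chi> j. z $ Inr j) $ j)"
    by (cases l) auto
qed (simp_all add: vec_eq_iff affine_product_def poly_funs.coord split: sum.split)

theorem proposition6p2:
  fixes X :: "(complex ^ 'n) set" and Y :: "(complex ^ 'm) set"
  assumes "complex_affine_manifold X" and "complex_affine_manifold Y"
    and "finitely_many_LNDs_infinitely_transitive X"
    and "finitely_many_LNDs_infinitely_transitive Y"
  shows "finitely_many_LNDs_infinitely_transitive (affine_product X Y)"
  by (rule product_coordinates.finitely_many_LNDs_product[OF product_coordinates_affine_product assms(3,4)])

end
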